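(* Let $n\ge2$ locations have detection rates $\lambda_1,\dots,\lambda_n>0$ and travel times $d_{ij}$. Among simple cycles, the best order in which to visit the locations is a minimum Hamiltonian cycle: for every choice of search durations $(x_1,\dots,x_n)\in(0,\infty)^n$ and every cyclic order of the locations, the simple cycle visiting the locations in that order with these durations has objective value $\max_iv_i$ at least as large as that of the simple cycle with the same durations visiting the locations along a minimum Hamiltonian cycle.
   Context: Travel times satisfy $d_{ij}>0$ for $i\neq j$, $d_{ii}=0$, and the triangle inequality; they need not be symmetric. A Hamiltonian cycle is a cyclic order of all $n$ locations; its travel time is the sum of the travel times between consecutive locations (including from the last back to the first), and it is minimum if this is smallest among all cyclic orders. A simple cycle visits the locations once each in a given cyclic order, searching location $i$ for $x_i$ time units, and repeats forever; its period $c$ is $\sum_jx_j$ plus the travel time of the cyclic order. While the patroller is searching location $i$, an attacker present there is detected at instantaneous rate $\lambda_i$; otherwise it is not detected. An attacker arriving at location $i$ at time $t$ is undetected at time $t+u$ with probability $e^{-\lambda_iS_i(t,t+u)}$, where $S_i(t,t+u)$ is the time spent searching location $i$ during $[t,t+u]$. The expected time to detect an attacker at location $i$ is $v_i=\frac1c\int_0^c\int_0^\infty e^{-\lambda_iS_i(t,t+u)}\,du\,dt$, and the patroller wants $\max_iv_i$ to be small. *)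

theory Defs
  imports "HOL-Analysis.Analysis"
begin

text \<open>The locations are \<open>0, \<dots>, n - 1\<close>; functions of locations are only ever used below \<open>n\<close>.\<close>

definition travel_times :: "nat \<Rightarrow> (nat \<Rightarrow> nat \<Rightarrow> real) \<Rightarrow> bool" where
  "travel_times n d \<longleftrightarrow>
     (\<forall>i<n. d i i = 0) \<and>
     (\<forall>i<n. \<forall>j<n. i \<noteq> j \<longrightarrow> d i j > 0) \<and>
     (\<forall>i<n. \<forall>j<n. \<forall>k<n. d i k \<le> d i j + d j k)"

text \<open>A cyclic order is given by listing the locations from an arbitrary starting point;
  the successor of the last entry is the first one.  Rotations of a list describe the same
  cyclic order.\<close>

definition cyclic_order :: "nat \<Rightarrow> nat list \<Rightarrow> bool" where
  "cyclic_order n w \<longleftrightarrow> distinct w \<and> set w = {..<n}"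

definition leg :: "(nat \<Rightarrow> nat \<Rightarrow> real) \<Rightarrow> nat list \<Rightarrow> nat \<Rightarrow> real" where
  "leg d w k = d (w ! k) (w ! (Suc k mod length w))"

definition cycle_travel_time :: "(nat \<Rightarrow> nat \<Rightarrow> real) \<Rightarrow> nat list \<Rightarrow> real" where
  "cycle_travel_time d w = (\<Sum>k<length w. leg d w k)"

definition min_hamiltonian_cycle :: "nat \<Rightarrow> (nat \<Rightarrow> nat \<Rightarrow> real) \<Rightarrow> nat list \<Rightarrow> bool" where
  "min_hamiltonian_cycle n d h \<longleftrightarrow>
     cyclic_order n h \<and>
     (\<forall>w. cyclic_order n w \<longrightarrow> cycle_travel_time d h \<le> cycle_travel_time d w)"

definition period :: "nat \<Rightarrow> (nat \<Rightarrow> nat \<Rightarrow> real) \<Rightarrow> (nat \<Rightarrow> real) \<Rightarrow> nat list \<Rightarrow> real" where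
  "period n d x w = (\<Sum>j<n. x j) + cycle_travel_time d w"

text \<open>The patroller starts searching \<open>w ! 0\<close> at time 0; \<open>search_start d x w k\<close> is the time at
  which the search of \<open>w ! k\<close> starts in the first round.\<close>

definition search_start ::
  "(nat \<Rightarrow> nat \<Rightarrow> real) \<Rightarrow> (nat \<Rightarrow> real) \<Rightarrow> nat list \<Rightarrow> nat \<Rightarrow> real" where
  "search_start d x w k = (\<Sum>j<k. x (w ! j) + leg d w j)"

definition searching_times ::
  "nat \<Rightarrow> (nat \<Rightarrow> nat \<Rightarrow> real) \<Rightarrow> (nat \<Rightarrow> real) \<Rightarrow> nat list \<Rightarrow> nat \<Rightarrow> real set" where
  "searching_times n d x w i =
     (\<Union>k\<in>{k. k < length w \<and> w ! k = i}. \<Union>m::nat.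
        {search_start d x w k + real m * period n d x w ..
         search_start d x w k + real m * period n d x w + x i})"

definition search_amount ::
  "nat \<Rightarrow> (nat \<Rightarrow> nat \<Rightarrow> real) \<Rightarrow> (nat \<Rightarrow> real) \<Rightarrow> nat list \<Rightarrow> nat \<Rightarrow> real \<Rightarrow> real \<Rightarrow> real" where
  "search_amount n d x w i a b = measure lborel ({a..b} \<inter> searching_times n d x w i)"

text \<open>The integrals are taken in \<^typ>\<open>ennreal\<close>, so that no integrability convention is involved.\<close>

definition expected_detection_time ::
  "nat \<Rightarrow> (nat \<Rightarrow> real) \<Rightarrow> (nat \<Rightarrow> nat \<Rightarrow> real) \<Rightarrow> (nat \<Rightarrow> real) \<Rightarrow> nat list \<Rightarrow> nat \<Rightarrow> ennreal" where
  "expected_detection_time n lam d x w i =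
     ennreal (1 / period n d x w) *
     (\<integral>\<^sup>+t\<in>{0..period n d x w}.
        (\<integral>\<^sup>+u\<in>{0..}. ennreal (exp (- lam i * search_amount n d x w i t (t + u))) \<partial>lborel)
      \<partial>lborel)"

definition objective ::
  "nat \<Rightarrow> (nat \<Rightarrow> real) \<Rightarrow> (nat \<Rightarrow> nat \<Rightarrow> real) \<Rightarrow> (nat \<Rightarrow> real) \<Rightarrow> nat list \<Rightarrow> ennreal" where
  "objective n lam d x w = Max (expected_detection_time n lam d x w ` {..<n})"

end

theory Submission imports Defs
begin

text \<open>
  The order of the visits influences the expected detection time at a location \<^term>\<open>i\<close> only through
  the period \<^term>\<open>c\<close>: whatever the order, \<^term>\<open>i\<close> is searched during one interval of length
  \<^term>\<open>x i\<close> per period, and where in the period this interval lies is irrelevant after averaging over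
  the arrival time.  Travelling along a minimum Hamiltonian cycle minimises the period, so it suffices
  that the expected detection time is increasing in the period; this then holds at every location
  separately, hence for the maximum.

  To see the monotonicity, the expected time is computed.  Write \<^term>\<open>L\<close> for the detection rate,
  \<^term>\<open>x\<close> for the search duration, \<^term>\<open>y = c - x\<close> for the time between two searches and
  \<^term>\<open>q = exp (- L * x)\<close> for the probability of surviving one search.  By the memoryless property of
  the exponential law (lemma \<open>mean_time_renewal\<close>), the expected time \<^term>\<open>a\<close> from the start of
  a search satisfies \<^term>\<open>a = (1 - q) / L + q * (y + a)\<close>.  This determines \<^term>\<open>a\<close>
  because it is finite, each period multiplying the survival probability by \<^term>\<open>q < 1\<close>.
  For other arrival times one waits for the next search, or conditions on surviving the current one.
  Integrating over a period (lemma \<open>integral_mean_time\<close>) gives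
  \<^term>\<open>(y\<^sup>2 * (1 / 2 + q / (1 - q)) + (x + 2 * y) / L) / c\<close>, in which both \<^term>\<open>y\<^sup>2 / c\<close> and
  \<^term>\<open>(x + 2 * y) / c = 2 - x / c\<close> increase with \<^term>\<open>c\<close>
  (lemma \<open>mean_detection_time_mono\<close>).
\<close>

section \<open>Splitting integrals over real intervals\<close>

lemma nn_set_integral_split_shift:
  fixes f :: "real \<Rightarrow> ennreal"
  assumes [measurable]: "f \<in> borel_measurable borel" "A \<in> sets borel"
  shows "(\<integral>\<^sup>+u\<in>A. f u \<partial>lborel) =
    (\<integral>\<^sup>+u\<in>A \<inter> {..r}. f u \<partial>lborel) + (\<integral>\<^sup>+v. f (r + v) * indicator (A \<inter> {r..}) (r + v) \<partial>lborel)"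
proof -
  have "(\<integral>\<^sup>+u\<in>A. f u \<partial>lborel) =
      (\<integral>\<^sup>+u. f u * indicator (A \<inter> {..r}) u + f u * indicator (A \<inter> {r..}) u \<partial>lborel)"
    using AE_lborel_singleton[of r]
    by (intro nn_integral_cong_AE) (auto elim!: eventually_mono split: split_indicator)
  also have "\<dots> = (\<integral>\<^sup>+u\<in>A \<inter> {..r}. f u \<partial>lborel) + (\<integral>\<^sup>+u\<in>A \<inter> {r..}. f u \<partial>lborel)"
    by (intro nn_integral_add) auto
  also have "(\<integral>\<^sup>+u\<in>A \<inter> {r..}. f u \<partial>lborel) =
      (\<integral>\<^sup>+v. f (r + v) * indicator (A \<inter> {r..}) (r + v) \<partial>lborel)"
    by (subst nn_integral_real_affine[where c = 1 and t = r]) auto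
  finally show ?thesis .
qed

text \<open>Measurability is only asked of the two formulas, so the lemma applies to a function
  \<^term>\<open>F\<close> that is known piecewise but not yet known to be measurable.\<close>

lemma nn_set_integral_Icc_append:
  fixes F :: "real \<Rightarrow> ennreal" and g h :: "real \<Rightarrow> real"
  assumes [measurable]: "g \<in> borel_measurable borel" "h \<in> borel_measurable borel"
    and "a \<le> b" "b \<le> c"
    and 1: "\<And>t. a \<le> t \<Longrightarrow> t \<le> b \<Longrightarrow> F t = ennreal (g t)"
    and 2: "\<And>t. b \<le> t \<Longrightarrow> t \<le> c \<Longrightarrow> F t = ennreal (h t)"
  shows "(\<integral>\<^sup>+t\<in>{a..c}. F t \<partial>lborel) =
    (\<integral>\<^sup>+t\<in>{a..b}. ennreal (g t) \<partial>lborel) + (\<integral>\<^sup>+t\<in>{b..c}. ennreal (h t) \<partial>lborel)"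
proof -
  have "(\<integral>\<^sup>+t\<in>{a..c}. F t \<partial>lborel) =
      (\<integral>\<^sup>+t. ennreal (g t) * indicator {a..b} t + ennreal (h t) * indicator {b..c} t \<partial>lborel)"
    using AE_lborel_singleton[of b] assms(3,4)
    by (intro nn_integral_cong_AE) (auto elim!: eventually_mono simp: 1 2 split: split_indicator)
  also have "\<dots> = (\<integral>\<^sup>+t\<in>{a..b}. ennreal (g t) \<partial>lborel) + (\<integral>\<^sup>+t\<in>{b..c}. ennreal (h t) \<partial>lborel)"
    by (intro nn_integral_add) auto
  finally show ?thesis .
qed

section \<open>The renewal argument at one location\<close>

text \<open>The expected detection time at a location searched with rate \<^term>\<open>L\<close> for \<^term>\<open>x\<close> time
  units in every period of length \<^term>\<open>c\<close>, averaged over the attacker's arrival time.\<close>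

definition mean_detection_time :: "real \<Rightarrow> real \<Rightarrow> real \<Rightarrow> real" where
  "mean_detection_time L x c =
     ((c - x)\<^sup>2 * (1 / 2 + exp (- L * x) / (1 - exp (- L * x))) + (x + 2 * (c - x)) / L) / c"

lemma mean_detection_time_mono:
  assumes "0 < x" "x \<le> c" "c \<le> c'" "0 < L"
  shows "mean_detection_time L x c \<le> mean_detection_time L x c'"
proof -
  define K where "K = 1 / 2 + exp (- L * x) / (1 - exp (- L * x))"
  have K: "0 \<le> K" using assms by (simp add: K_def)
  \<comment> \<open>This product is the difference of the two sides of the next inequality.\<close>
  have "0 \<le> (c' - c) * (c * c' - x\<^sup>2)"
    using assms by (intro mult_nonneg_nonneg) (auto simp: power2_eq_square intro!: mult_mono)
  then have "(c - x)\<^sup>2 * c' \<le> (c' - x)\<^sup>2 * c"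
    by (simp add: power2_eq_square algebra_simps)
  then have "(c - x)\<^sup>2 / c \<le> (c' - x)\<^sup>2 / c'"
    using assms by (simp add: field_simps)
  then have 1: "(c - x)\<^sup>2 / c * K \<le> (c' - x)\<^sup>2 / c' * K"
    using K by (intro mult_right_mono)
  have "x * c \<le> x * c'" using assms by (intro mult_left_mono) auto
  then have "(x + 2 * (c - x)) / c \<le> (x + 2 * (c' - x)) / c'"
    using assms by (simp add: field_simps)
  then have 2: "(x + 2 * (c - x)) / c / L \<le> (x + 2 * (c' - x)) / c' / L"
    using assms(4) by (intro divide_right_mono) auto
  from 1 2 show ?thesis
    unfolding mean_detection_time_def K_def[symmetric]
    by (simp add: add_divide_distrib mult.commute)
qed

text \<open>Searching starts at the times \<^term>\<open>s + real m * c\<close>.  By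
  \<^term>\<open>s + x < c\<close> the first search ends within the first period.  The pattern is therefore
  invariant under shifts by \<^term>\<open>c\<close> from time 0 on, although there is no search before that:
  a search reaching past the end of its period would have a continuation at time \<^term>\<open>c\<close> that is
  missing at time 0.\<close>

locale periodic_search =
  fixes s c x L :: real
  assumes s: "0 \<le> s" and x: "0 < x" and sxc: "s + x < c" and L: "0 < L"
begin

definition searched :: "real set" where
  "searched = (\<Union>m::nat. {s + real m * c .. s + real m * c + x})"

definition amount :: "real \<Rightarrow> real \<Rightarrow> real" where
  "amount a b = measure lborel ({a..b} \<inter> searched)"

definition undetected :: "real \<Rightarrow> real \<Rightarrow> real" where
  "undetected t u = exp (- L * amount t (t + u))"

definition mean_time :: "real \<Rightarrow> ennreal" where
  "mean_time t = (\<integral>\<^sup>+u\<in>{0..}. ennreal (undetected t u) \<partial>lborel)"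

definition q :: real where "q = exp (- L * x)"

lemma c_pos: "0 < c" using s x sxc by simp

lemma q: "0 < q" "q < 1"
  using L x by (auto simp: q_def)

lemma searched_sets [measurable]: "searched \<in> sets borel"
  unfolding searched_def by (intro sets.countable_UN) auto

lemma Icc_searched_fmeasurable: "{a..b} \<inter> searched \<in> fmeasurable lborel"
  by (rule fmeasurableI2[of "{a..b}"]) (auto simp: fmeasurable_def emeasure_lborel_Icc_eq)

lemma amount_mono: "a' \<le> a \<Longrightarrow> b \<le> b' \<Longrightarrow> amount a b \<le> amount a' b'"
  unfolding amount_def by (intro measure_mono_fmeasurable Icc_searched_fmeasurable) auto

lemma amount_split:
  assumes "a \<le> b" "b \<le> d"
  shows "amount a d = amount a b + amount b d"
proof -
  have "{a..d} \<inter> searched = ({a..b} \<inter> searched) \<union> ({b..d} \<inter> searched)" using assms by auto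
  moreover have "AE t in lborel. t \<notin> {a..b} \<inter> searched \<or> t \<notin> {b..d} \<inter> searched"
    using AE_lborel_singleton[of b] by (auto elim!: eventually_mono)
  ultimately show ?thesis
    by (simp only: amount_def measure_Un_AE Icc_searched_fmeasurable)
qed

lemma searched_first_period:
  assumes "0 \<le> t" "t < s + c"
  shows "t \<in> searched \<longleftrightarrow> s \<le> t \<and> t \<le> s + x"
proof
  assume "t \<in> searched"
  then obtain m :: nat where m: "s + real m * c \<le> t" "t \<le> s + real m * c + x"
    by (auto simp: searched_def)
  have "m = 0"
  proof (rule ccontr)
    assume "m \<noteq> 0"
    then have "1 * c \<le> real m * c" using c_pos by (intro mult_right_mono) auto
    with m assms show False by simp
  qed
  with m show "s \<le> t \<and> t \<le> s + x" by simp
next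
  assume "s \<le> t \<and> t \<le> s + x"
  then show "t \<in> searched" by (auto simp: searched_def intro!: exI[of _ "0::nat"])
qed

lemma searched_shift:
  assumes "0 \<le> t"
  shows "t + c \<in> searched \<longleftrightarrow> t \<in> searched"
proof
  assume "t \<in> searched"
  then obtain m :: nat where "s + real m * c \<le> t" "t \<le> s + real m * c + x"
    by (auto simp: searched_def)
  then show "t + c \<in> searched"
    by (auto simp: searched_def algebra_simps intro!: exI[of _ "Suc m"])
next
  assume "t + c \<in> searched"
  then obtain m :: nat where m: "s + real m * c \<le> t + c" "t + c \<le> s + real m * c + x"
    by (auto simp: searched_def)
  with assms sxc have "m \<noteq> 0" by (intro notI) simp
  then obtain k where "m = Suc k" using not0_implies_Suc by blast
  with m show "t \<in> searched" by (auto simp: searched_def algebra_simps intro!: exI[of _ k])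
qed

lemma amount_shift:
  assumes "0 \<le> a"
  shows "amount (a + c) (b + c) = amount a b"
proof -
  have eq: "(+) c -` ({a + c..b + c} \<inter> searched) = {a..b} \<inter> searched"
    using assms searched_shift by (auto simp: add.commute)
  have "amount (a + c) (b + c) = measure (distr lborel borel ((+) c)) ({a + c..b + c} \<inter> searched)"
    by (simp add: amount_def lborel_distr_plus)
  also have "\<dots> = measure lborel ((+) c -` ({a + c..b + c} \<inter> searched))"
    by (subst measure_distr) auto
  finally show ?thesis by (simp only: eq amount_def)
qed

text \<open>Up to \<^term>\<open>s + c\<close>, where the second search starts, only the first search
  contributes.\<close>

lemma amount_eq:
  assumes "0 \<le> a" "a \<le> b" "b \<le> s + c"
  shows "amount a b = max 0 (min b (s + x) - max a s)"
proof -
  have "amount a b = measure lborel {max a s .. min b (s + x)}"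
    unfolding amount_def
  proof (rule measure_eq_AE)
    show "AE t in lborel. t \<in> {a..b} \<inter> searched \<longleftrightarrow> t \<in> {max a s..min b (s + x)}"
      using AE_lborel_singleton[of "s + c"]
    proof (rule eventually_mono)
      fix t :: real assume "t \<noteq> s + c"
      then show "t \<in> {a..b} \<inter> searched \<longleftrightarrow> t \<in> {max a s..min b (s + x)}"
        using searched_first_period[of t] assms by auto
    qed
  qed auto
  then show ?thesis by (auto simp: max_def)
qed

lemma undetected_measurable [measurable]: "undetected t \<in> borel_measurable borel"
proof -
  have [measurable]: "(\<lambda>u. amount t (t + u)) \<in> borel_measurable borel"
    by (intro borel_measurable_mono monoI amount_mono) auto
  show ?thesis unfolding undetected_def by measurable
qed

lemma undetected_nonneg [simp]: "0 \<le> undetected t u"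
  by (simp add: undetected_def)

lemma undetected_le_1: "undetected t u \<le> 1"
  using L by (simp add: undetected_def amount_def)

lemma undetected_add:
  "0 \<le> u \<Longrightarrow> 0 \<le> v \<Longrightarrow> undetected t (u + v) = undetected t u * undetected (t + u) v"
  using amount_split[of t "t + u" "t + u + v"]
  by (simp add: undetected_def distrib_left add.assoc exp_add[symmetric] del: exp_add)

lemma undetected_shift: "0 \<le> t \<Longrightarrow> undetected (t + c) u = undetected t u"
  using amount_shift[of t "t + u"] by (simp add: undetected_def algebra_simps)

text \<open>The integration set \<^term>\<open>A\<close> is left arbitrary to cover both the full half-line, which gives the
  renewal equation, and bounded intervals, which give finiteness.\<close>

lemma undetected_integral_split:
  assumes "A \<in> sets borel" "A \<subseteq> {0..}" "0 \<le> r"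
  shows "(\<integral>\<^sup>+u\<in>A. ennreal (undetected t u) \<partial>lborel) =
    (\<integral>\<^sup>+u\<in>A \<inter> {..r}. ennreal (undetected t u) \<partial>lborel) +
    ennreal (undetected t r) *
      (\<integral>\<^sup>+v. ennreal (undetected (t + r) v) * indicator (A \<inter> {r..}) (r + v) \<partial>lborel)"
proof -
  note [measurable] = assms(1)
  have "(\<integral>\<^sup>+v. ennreal (undetected t (r + v)) * indicator (A \<inter> {r..}) (r + v) \<partial>lborel) =
    (\<integral>\<^sup>+v. ennreal (undetected t r) * (ennreal (undetected (t + r) v) * indicator (A \<inter> {r..}) (r + v)) \<partial>lborel)"
    using assms(3)
    by (intro nn_integral_cong) (auto simp: undetected_add ennreal_mult split: split_indicator)
  also have "\<dots> = ennreal (undetected t r) *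
      (\<integral>\<^sup>+v. ennreal (undetected (t + r) v) * indicator (A \<inter> {r..}) (r + v) \<partial>lborel)"
    by (intro nn_integral_cmult) auto
  finally show ?thesis
    by (subst nn_set_integral_split_shift[where r = r]) auto
qed

lemma mean_time_renewal:
  assumes "0 \<le> r"
  shows "mean_time t = (\<integral>\<^sup>+u\<in>{0..r}. ennreal (undetected t u) \<partial>lborel) + ennreal (undetected t r) * mean_time (t + r)"
proof -
  have "{0..} \<inter> {..r} = {0..r}" by auto
  moreover have "indicator ({0..} \<inter> {r..}) (r + v) = (indicator {0..} v :: ennreal)" for v
    using assms by (auto split: split_indicator)
  ultimately show ?thesis
    using assms undetected_integral_split[of "{0..}" r t] by (simp add: mean_time_def)
qed

lemma mean_time_shift: "0 \<le> t \<Longrightarrow> mean_time (t + c) = mean_time t"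
  by (simp add: mean_time_def undetected_shift)

lemma undetected_period: "undetected s c = q"
  using s x sxc amount_eq[of s "s + c"] by (simp add: undetected_def q_def)

text \<open>The renewal equation alone does not exclude the value \<^term>\<open>\<infinity>::ennreal\<close>.  The integrals
  truncated at \<^term>\<open>N\<close> are finite because the integrand is at most 1, and they satisfy
  \<^term>\<open>T N \<le> c + q * T N\<close>; solving this bounds them uniformly in \<^term>\<open>N\<close>.\<close>

lemma mean_time_start_finite: "mean_time s < \<infinity>"
proof -
  define T where "T N = (\<integral>\<^sup>+u\<in>{0..N}. ennreal (undetected s u) \<partial>lborel)" for N :: real
  have T_le: "T N \<le> ennreal N" if "0 \<le> N" for N
  proof -
    have "T N \<le> (\<integral>\<^sup>+u. indicator {0..N} u \<partial>lborel)"
      unfolding T_def using undetected_le_1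
      by (intro nn_integral_mono) (auto split: split_indicator)
    with that show ?thesis by simp
  qed
  have bound: "T N \<le> ennreal (c / (1 - q))" if N: "0 \<le> N" for N
  proof -
    have "T N = (\<integral>\<^sup>+u\<in>{0..N} \<inter> {..c}. ennreal (undetected s u) \<partial>lborel) +
      ennreal q * (\<integral>\<^sup>+v. ennreal (undetected (s + c) v) * indicator ({0..N} \<inter> {c..}) (c + v) \<partial>lborel)"
      unfolding T_def using c_pos
      by (subst undetected_integral_split[where r = c]) (auto simp: undetected_period)
    also have "\<dots> \<le> T c + ennreal q * T N"
      unfolding T_def using c_pos s
      by (intro add_mono mult_left_mono nn_integral_mono)
         (auto simp: undetected_shift split: split_indicator)
    finally have *: "T N \<le> ennreal c + ennreal q * T N"
      using T_le[of c] c_pos by (meson add_right_mono order_trans less_imp_le)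
    from T_le[OF N] obtain a where a: "T N = ennreal a" "0 \<le> a"
      by (cases "T N") (auto simp: top_unique)
    with * have "a \<le> c + q * a"
      using q c_pos by (simp flip: ennreal_mult ennreal_plus)
    with q have "a \<le> c / (1 - q)" by (simp add: field_simps)
    with a show ?thesis by (simp add: ennreal_leI)
  qed
  have "mean_time s = (\<integral>\<^sup>+u. (SUP N::nat. ennreal (undetected s u) * indicator {0..real N} u) \<partial>lborel)"
    unfolding mean_time_def
  proof (rule nn_integral_cong)
    fix u :: real
    obtain M :: nat where "u \<le> real M" using real_arch_simple by blast
    then show "ennreal (undetected s u) * indicator {0..} u =
        (SUP N::nat. ennreal (undetected s u) * indicator {0..real N} u)"
      by (intro antisym SUP_upper2[of M] SUP_least) (auto split: split_indicator)
  qed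
  also have "\<dots> = (SUP N::nat. T (real N))"
    unfolding T_def
    by (intro nn_integral_monotone_convergence_SUP)
       (auto simp: incseq_def le_fun_def split: split_indicator)
  also have "\<dots> \<le> ennreal (c / (1 - q))"
    by (intro SUP_least bound) simp
  finally show ?thesis by (simp add: le_less_trans)
qed

text \<open>The solution \<^term>\<open>a\<close> of \<^term>\<open>a = (1 - q) / L + q * (c - x + a)\<close>.\<close>

definition mean_from_start :: real where "mean_from_start = 1 / L + q * (c - x) / (1 - q)"

lemma mean_from_start_nonneg: "0 \<le> mean_from_start"
  using q L s sxc by (simp add: mean_from_start_def)

lemma undetected_gap:
  assumes "0 \<le> t" "0 \<le> u" "t + u \<le> s + c" "t + u \<le> s \<or> s + x \<le> t"
  shows "undetected t u = 1"
  using assms amount_eq[of t "t + u"] by (auto simp: undetected_def)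

text \<open>Waiting outside the searches adds its full length to the detection time.\<close>

lemma mean_time_gap:
  assumes "0 \<le> t" "0 \<le> u" "t + u \<le> s + c" "t + u \<le> s \<or> s + x \<le> t"
  shows "mean_time t = ennreal u + mean_time (t + u)"
proof -
  have "(\<integral>\<^sup>+v\<in>{0..u}. ennreal (undetected t v) \<partial>lborel) = (\<integral>\<^sup>+v. indicator {0..u} v \<partial>lborel)"
    using assms
    by (intro nn_integral_cong) (auto simp: undetected_gap split: split_indicator)
  then show ?thesis
    using assms mean_time_renewal[of u t] by (simp add: undetected_gap)
qed

text \<open>The attacker is either detected during the rest of the current search, or survives it and is
  then at its end.\<close>

lemma mean_time_search:
  assumes "s \<le> t" "t \<le> s + x"
  shows "mean_time t = ennreal ((1 - exp (- L * (s + x - t))) / L) + ennreal (exp (- L * (s + x - t))) * mean_time (s + x)"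
proof -
  define r where "r = s + x - t"
  have r: "0 \<le> r" using assms by (simp add: r_def)
  have un: "undetected t v = exp (- L * v)" if "0 \<le> v" "v \<le> r" for v
    using that assms s x sxc amount_eq[of t "t + v"] by (simp add: undetected_def r_def)
  have "(\<integral>\<^sup>+v\<in>{0..r}. ennreal (undetected t v) \<partial>lborel) =
      (\<integral>\<^sup>+v. ennreal (exp (- L * v)) * indicator {0..r} v \<partial>lborel)"
    by (intro nn_integral_cong) (auto simp: un split: split_indicator)
  also have "\<dots> = ennreal (- exp (- L * r) / L - (- exp (- L * 0) / L))"
    using L r
    by (intro nn_integral_FTC_Icc) (auto intro!: derivative_eq_intros)
  also have "- exp (- L * r) / L - (- exp (- L * 0) / L) = (1 - exp (- L * r)) / L"
    by (simp add: diff_divide_distrib)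
  finally show ?thesis
    using mean_time_renewal[OF r, of t] un[of r] r by (simp add: r_def)
qed

lemma mean_time_after: "mean_time (s + x) = ennreal (c - x) + mean_time s"
  using mean_time_gap[of "s + x" "c - x"] s x sxc mean_time_shift[of s] by simp

lemma mean_time_start: "mean_time s = ennreal mean_from_start"
proof -
  obtain a where a: "mean_time s = ennreal a" "0 \<le> a"
    using mean_time_start_finite by (cases "mean_time s") auto
  have "mean_time s = ennreal ((1 - q) / L) + ennreal q * (ennreal (c - x) + mean_time s)"
    using mean_time_search[of s] x mean_time_after by (simp add: q_def)
  then have "a = (1 - q) / L + q * (c - x + a)"
    using a q L s x sxc by (simp flip: ennreal_mult ennreal_plus)
  then have "a * (1 - q) = (1 - q) / L + q * (c - x)" by (simp add: algebra_simps)
  then have "a = mean_from_start" using q unfolding mean_from_start_def by (simp add: field_simps)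
  with a show ?thesis by simp
qed

text \<open>The three formulas for the mean detection time, at arrivals before, during and after the first
  search, are integrated separately; all terms involving \<^term>\<open>s\<close> cancel in the sum.\<close>

lemma integral_mean_time: "(\<integral>\<^sup>+t\<in>{0..c}. mean_time t \<partial>lborel) = ennreal (c * mean_detection_time L x c)"
proof -
  define total where "total = (c - x)\<^sup>2 * (1 / 2 + q / (1 - q)) + (x + 2 * (c - x)) / L"
  \<comment> \<open>The mean detection time for arrivals at the end of a search.\<close>
  define B where "B = c - x + mean_from_start"
  have B: "0 \<le> B" using mean_from_start_nonneg s sxc by (simp add: B_def)
  \<comment> \<open>The mean detection times for arrivals before, during and after the first search, the second one
    arranged as a constant plus a multiple of an exponential.\<close>
  define g1 where "g1 t = s - t + mean_from_start" for t
  define g2 where "g2 t = 1 / L + exp (- L * (s + x - t)) * (B - 1 / L)" for t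
  define g3 where "g3 t = c + s - t + mean_from_start" for t
  have F1: "mean_time t = ennreal (g1 t)" if "0 \<le> t" "t \<le> s" for t
    using mean_time_gap[of t "s - t"] mean_time_start that mean_from_start_nonneg c_pos by (simp add: g1_def)
  have F2: "mean_time t = ennreal (g2 t)" if "s \<le> t" "t \<le> s + x" for t
  proof -
    have "exp (- L * (s + x - t)) \<le> 1" using that L by simp
    then have "mean_time t = ennreal ((1 - exp (- L * (s + x - t))) / L + exp (- L * (s + x - t)) * B)"
      using mean_time_search[OF that] mean_time_after mean_time_start mean_from_start_nonneg B L s sxc
      by (simp add: B_def flip: ennreal_mult ennreal_plus)
    also have "(1 - exp (- L * (s + x - t))) / L + exp (- L * (s + x - t)) * B = g2 t"
      using L by (simp add: g2_def field_simps)
    finally show ?thesis .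
  qed
  have F3: "mean_time t = ennreal (g3 t)" if "s + x \<le> t" "t \<le> c" for t
    using mean_time_gap[of t "s + c - t"] mean_time_shift[of s] mean_time_start that mean_from_start_nonneg s x
    by (simp add: g3_def add.commute)
  have BL: "0 \<le> B - 1 / L"
  proof -
    have "0 \<le> q * (c - x) / (1 - q)" using q sxc s by simp
    then show ?thesis using sxc s by (simp add: B_def mean_from_start_def)
  qed
  have [measurable]: "g1 \<in> borel_measurable borel" "g2 \<in> borel_measurable borel"
      "g3 \<in> borel_measurable borel"
    unfolding g1_def g2_def g3_def by measurable
  define g23 where "g23 t = (if t \<le> s + x then g2 t else g3 t)" for t
  have [measurable]: "g23 \<in> borel_measurable borel" unfolding g23_def by measurable
  have F23: "mean_time t = ennreal (g23 t)" if "s \<le> t" "t \<le> c" for t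
    using F2 F3 that by (auto simp: g23_def)
  have "(\<integral>\<^sup>+t\<in>{0..c}. mean_time t \<partial>lborel) = (\<integral>\<^sup>+t\<in>{0..s}. ennreal (g1 t) \<partial>lborel) +
      (\<integral>\<^sup>+t\<in>{s..c}. ennreal (g23 t) \<partial>lborel)"
    using F1 F23 s x sxc by (intro nn_set_integral_Icc_append) auto
  also have "(\<integral>\<^sup>+t\<in>{s..c}. ennreal (g23 t) \<partial>lborel) =
      (\<integral>\<^sup>+t\<in>{s..s + x}. ennreal (g2 t) \<partial>lborel) + (\<integral>\<^sup>+t\<in>{s + x..c}. ennreal (g3 t) \<partial>lborel)"
  proof (rule nn_set_integral_Icc_append)
    show "ennreal (g23 t) = ennreal (g2 t)" if "s \<le> t" "t \<le> s + x" for t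
      using that sxc F2[of t] F23[of t] by simp
    show "ennreal (g23 t) = ennreal (g3 t)" if "s + x \<le> t" "t \<le> c" for t
      using that x F3[of t] F23[of t] by simp
  qed (use x sxc in auto)
  also have "(\<integral>\<^sup>+t\<in>{0..s}. ennreal (g1 t) \<partial>lborel) = ennreal (s\<^sup>2 / 2 + mean_from_start * s)"
  proof -
    have "(\<integral>\<^sup>+t\<in>{0..s}. ennreal (g1 t) \<partial>lborel) =
        ennreal (((s + mean_from_start) * s - s\<^sup>2 / 2) - ((s + mean_from_start) * 0 - 0\<^sup>2 / 2))"
      by (rule nn_integral_FTC_Icc)
         (use s mean_from_start_nonneg in \<open>auto intro!: derivative_eq_intros simp: g1_def\<close>)
    also have "((s + mean_from_start) * s - s\<^sup>2 / 2) - ((s + mean_from_start) * 0 - 0\<^sup>2 / 2) = s\<^sup>2 / 2 + mean_from_start * s"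
      by (simp add: algebra_simps power2_eq_square)
    finally show ?thesis .
  qed
  also have "(\<integral>\<^sup>+t\<in>{s..s + x}. ennreal (g2 t) \<partial>lborel) =
      ennreal (x / L + (1 - q) / L * (B - 1 / L))"
  proof -
    define D where "D = B - 1 / L"
    have "(\<integral>\<^sup>+t\<in>{s..s + x}. ennreal (g2 t) \<partial>lborel) =
        ennreal (((s + x) / L + exp (- L * (s + x - (s + x))) / L * D) -
          (s / L + exp (- L * (s + x - s)) / L * D))"
      by (rule nn_integral_FTC_Icc)
         (use x L BL in \<open>auto intro!: derivative_eq_intros simp: g2_def D_def[symmetric]\<close>)
    also have "((s + x) / L + exp (- L * (s + x - (s + x))) / L * D) -
          (s / L + exp (- L * (s + x - s)) / L * D) = x / L + (1 - q) / L * D"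
      by (simp add: q_def add_divide_distrib diff_divide_distrib left_diff_distrib)
    finally show ?thesis by (simp add: D_def)
  qed
  also have "(\<integral>\<^sup>+t\<in>{s + x..c}. ennreal (g3 t) \<partial>lborel) =
      ennreal (((c - x)\<^sup>2 - s\<^sup>2) / 2 + mean_from_start * (c - x - s))"
  proof -
    have "(\<integral>\<^sup>+t\<in>{s + x..c}. ennreal (g3 t) \<partial>lborel) =
        ennreal (((c + s + mean_from_start) * c - c\<^sup>2 / 2) - ((c + s + mean_from_start) * (s + x) - (s + x)\<^sup>2 / 2))"
      by (rule nn_integral_FTC_Icc)
         (use s sxc mean_from_start_nonneg in \<open>auto intro!: derivative_eq_intros simp: g3_def\<close>)
    also have "((c + s + mean_from_start) * c - c\<^sup>2 / 2) - ((c + s + mean_from_start) * (s + x) - (s + x)\<^sup>2 / 2) =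
        ((c - x)\<^sup>2 - s\<^sup>2) / 2 + mean_from_start * (c - x - s)"
      by (simp add: power2_eq_square field_simps)
    finally show ?thesis .
  qed
  also have "ennreal (s\<^sup>2 / 2 + mean_from_start * s) + (ennreal (x / L + (1 - q) / L * (B - 1 / L)) +
      ennreal (((c - x)\<^sup>2 - s\<^sup>2) / 2 + mean_from_start * (c - x - s))) =
      ennreal (s\<^sup>2 / 2 + mean_from_start * s + (x / L + (1 - q) / L * (B - 1 / L) +
        (((c - x)\<^sup>2 - s\<^sup>2) / 2 + mean_from_start * (c - x - s))))"
    using s x L q BL mean_from_start_nonneg sxc
    by (simp flip: ennreal_plus)
  also have "s\<^sup>2 / 2 + mean_from_start * s + (x / L + (1 - q) / L * (B - 1 / L) +
        (((c - x)\<^sup>2 - s\<^sup>2) / 2 + mean_from_start * (c - x - s))) = total"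
  proof -
    have "(1 - q) * (B - 1 / L) = c - x"
      using q by (simp add: B_def mean_from_start_def field_simps)
    then have "(1 - q) / L * (B - 1 / L) = (c - x) / L" by (simp add: field_simps)
    then show ?thesis
      by (simp add: total_def mean_from_start_def add_divide_distrib diff_divide_distrib algebra_simps power2_eq_square)
  qed
  also have "total = c * mean_detection_time L x c"
    using c_pos by (simp add: total_def q_def mean_detection_time_def)
  finally show ?thesis .
qed

end

section \<open>Simple cycles\<close>

lemma cyclic_order_length: "cyclic_order n w \<Longrightarrow> length w = n"
  unfolding cyclic_order_def by (metis card_lessThan distinct_card)

lemma leg_pos:
  assumes "n \<ge> 2" "travel_times n d" "cyclic_order n w" "k < n"
  shows "0 < leg d w k"
proof -
  have len: "length w = n" using assms(3) by (rule cyclic_order_length)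
  have "k \<noteq> Suc k mod n" using assms(1,4)
    by (cases "Suc k = n") auto
  moreover have "Suc k mod n < n" using assms(1) by simp
  ultimately have "w ! k \<noteq> w ! (Suc k mod n)" "w ! k < n" "w ! (Suc k mod n) < n"
    using assms(3,4) len nth_mem[of k w] nth_mem[of "Suc k mod n" w]
    by (auto simp: cyclic_order_def nth_eq_iff_index_eq)
  with assms(2) len show ?thesis by (auto simp: leg_def travel_times_def)
qed

text \<open>Summing the durations by location or by index in the order is the same, so one round ends
  exactly after a period.\<close>

lemma period_eq_search_start:
  assumes "cyclic_order n w"
  shows "period n d x w = search_start d x w n"
proof -
  have "bij_betw ((!) w) {..<n} {..<n}"
    using assms cyclic_order_length[OF assms] by (simp add: bij_betw_nth cyclic_order_def)
  then have "(\<Sum>j<n. x j) = (\<Sum>j<n. x (w ! j))"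
    by (simp add: sum.reindex_bij_betw[of "(!) w" _ _ x])
  with cyclic_order_length[OF assms] show ?thesis
    by (simp add: period_def search_start_def cycle_travel_time_def sum.distrib)
qed

text \<open>Each location has exactly one index in the cyclic order, and its search, followed by a leg of
  positive length, fits into one period; so the renewal computation applies.\<close>

lemma expected_detection_time_eq:
  assumes n: "n \<ge> 2" and L: "lam i > 0" and tt: "travel_times n d"
    and xpos: "\<And>i. i < n \<Longrightarrow> x i > 0" and w: "cyclic_order n w" and i: "i < n"
  shows "expected_detection_time n lam d x w i =
      ennreal (mean_detection_time (lam i) (x i) (period n d x w))"
    and "x i < period n d x w"
proof -
  have len: "length w = n" using w by (rule cyclic_order_length)
  from w i len obtain k where k: "k < n" "w ! k = i"
    by (metis cyclic_order_def in_set_conv_nth lessThan_iff)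
  have visits: "{k. k < length w \<and> w ! k = i} = {k}"
    using k w len nth_eq_iff_index_eq[of w _ k] by (auto simp: cyclic_order_def)
  define s where "s = search_start d x w k"
  define c where "c = period n d x w"
  have step: "0 < x (w ! j) + leg d w j" if "j < n" for j
    using that leg_pos[OF n tt w that] xpos[of "w ! j"] w len nth_mem[of j w]
    by (auto simp: cyclic_order_def)
  have "0 \<le> s"
    unfolding s_def search_start_def using k step by (intro sum_nonneg) (auto intro: less_imp_le)
  moreover have "s + x i < c"
  proof -
    have "s + x i < search_start d x w (Suc k)"
      using leg_pos[OF n tt w] k by (simp add: s_def search_start_def)
    also have "\<dots> \<le> search_start d x w n"
      unfolding search_start_def using k step by (intro sum_mono2) (auto intro: less_imp_le)
    finally show ?thesis by (simp add: c_def period_eq_search_start[OF w])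
  qed
  ultimately interpret periodic_search s c "x i" "lam i"
    using L xpos[OF i] by unfold_locales
  have "searching_times n d x w i = searched"
    by (simp add: searching_times_def visits searched_def flip: s_def c_def)
  then have "expected_detection_time n lam d x w i = ennreal (1 / c) * (\<integral>\<^sup>+t\<in>{0..c}. mean_time t \<partial>lborel)"
    by (simp add: expected_detection_time_def search_amount_def mean_time_def undetected_def amount_def flip: c_def)
  also have "\<dots> = ennreal (mean_detection_time (lam i) (x i) c)"
    using c_pos by (simp add: integral_mean_time flip: ennreal_mult')
  finally show "expected_detection_time n lam d x w i =
      ennreal (mean_detection_time (lam i) (x i) (period n d x w))"
    by (simp add: c_def)
  show "x i < period n d x w" using s sxc by (simp add: c_def)
qed

theorem mainTheorem6:
  fixes n :: nat
    and lam :: "nat \<Rightarrow> real"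
    and d :: "nat \<Rightarrow> nat \<Rightarrow> real"
    and x :: "nat \<Rightarrow> real"
    and w h :: "nat list"
  assumes "n \<ge> 2"
    and "\<And>i. i < n \<Longrightarrow> lam i > 0"
    and "travel_times n d"
    and "\<And>i. i < n \<Longrightarrow> x i > 0"
    and "cyclic_order n w"
    and "min_hamiltonian_cycle n d h"
  shows "objective n lam d x h \<le> objective n lam d x w"
proof -
  have h: "cyclic_order n h" and le: "period n d x h \<le> period n d x w"
    using assms(5,6) by (auto simp: min_hamiltonian_cycle_def period_def)
  have "expected_detection_time n lam d x h i \<le> expected_detection_time n lam d x w i"
    if i: "i < n" for i
  proof -
    note time = expected_detection_time_eq[where x = x and i = i and lam = lam,
        OF assms(1) assms(2)[OF i] assms(3) assms(4) _ i]
    have "mean_detection_time (lam i) (x i) (period n d x h) \<le>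
        mean_detection_time (lam i) (x i) (period n d x w)"
      using assms(2,4)[OF i] le time(2)[OF _ h]
      by (intro mean_detection_time_mono) (auto intro: less_imp_le)
    then show ?thesis
      using time(1)[OF _ h] time(1)[OF _ assms(5)] by (simp add: ennreal_leI)
  qed
  moreover have "expected_detection_time n lam d x w i \<le> objective n lam d x w" if "i < n" for i
    unfolding objective_def using that by (intro Max_ge) auto
  ultimately have "expected_detection_time n lam d x h i \<le> objective n lam d x w" if "i < n" for i
    using that order_trans by blast
  moreover have "{..<n} \<noteq> {}" using assms(1) by (simp add: lessThan_empty_iff)
  ultimately show ?thesis
    unfolding objective_def[of n lam d x h] by (intro Max.boundedI) auto
qed

end
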